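(* Equip $\mathbb{R}^3$ with global coordinates $(x,y,t)$ and the Riemannian metric $ds^2=dx^2+dy^2+(dt-x\,dy)^2$ (this is the model geometry $\mathbf{Nil}$). (1) Let $h_1,h_2:\mathbb{C}\to\mathbb{C}$ be holomorphic functions and let $a=(a_1,a_2)\in\mathbb{C}^2$ be non-zero. Then the function $f_1:\mathbf{Nil}\to\mathbb{C}$, $f_1(x,y,t)=h_1(x+iy)+h_2(x-iy)+a_1t+a_2xt$, is non-constant and harmonic, i.e. $f_1\neq 0$ and $\tau(f_1)=0$. (2) Let $b=(b_1,\dots,b_{12})\in\mathbb{C}^{12}$ be non-zero and define $f_2:\mathbf{Nil}\to\mathbb{C}$ by $$f_2(x,y,t)=b_1x^2+b_2y^2+b_3yt+b_4x^3+b_5x^2y+b_6x^2t+b_7xy^2+b_8y^3+b_9x^3y+b_{10}xy^3+b_{11}y^2t+b_{12}x^3t.$$ Then $$\tau(f_2)=2b_1+2b_2+2b_3x+6b_4x+2b_5y+2b_6t+2b_7x+6b_8y+6b_9xy+6b_{10}xy+2b_{11}(t+2xy)+6b_{12}xt$$ and $\tau^2(f_2)=0$. Hence the function $f_2:\mathbf{Nil}\to\mathbb{C}$ provides a $12$-dimensional family of proper biharmonic functions on $\mathbf{Nil}$.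
   Context: For a Riemannian manifold $(M,g)$, $\tau=\operatorname{div}\nabla$ denotes the Laplace-Beltrami operator acting on smooth complex-valued functions (the metric being extended complex-bilinearly), and $\tau^2(f)=\tau(\tau(f))$. A function $f:(M,g)\to\mathbb{C}$ is harmonic if $\tau(f)=0$, biharmonic if $\tau^2(f)=0$, and proper biharmonic if $\tau^2(f)=0$ and $\tau(f)$ does not vanish identically. On $\mathbf{Nil}$ the operator is $\tau(f)=\frac{\partial^2 f}{\partial x^2}+\frac{\partial^2 f}{\partial y^2}+2x\frac{\partial^2 f}{\partial y\partial t}+(1+x^2)\frac{\partial^2 f}{\partial t^2}$.
   Formalization: Not every non-zero b gives a proper biharmonic f_2 (x^2-y^2 is harmonic); instead: f_2 is proper exactly when the polynomial tau(f_2) has a non-zero coefficient, such b are open and dense in C^12, b -> f_2 is injective, and the proper members span dimension 12. *)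

theory Defs
  imports "HOL-Analysis.Analysis" "HOL-Library.Function_Algebras"
begin

definition partial_deriv :: "'n \<Rightarrow> (real^'n \<Rightarrow> complex) \<Rightarrow> real^'n \<Rightarrow> complex" where
  "partial_deriv i f p = vector_derivative (\<lambda>s. f (p + s *\<^sub>R axis i 1)) (at 0)"

text \<open>Smooth means \<open>C\<^sup>\<infinity>\<close>: every iterated partial derivative exists and is (totally)
  differentiable, hence continuous. The head of the list is applied last.\<close>

primrec iterated_partial_deriv :: "'n list \<Rightarrow> (real^'n \<Rightarrow> complex) \<Rightarrow> real^'n \<Rightarrow> complex" where
  "iterated_partial_deriv [] f = f"
| "iterated_partial_deriv (i # is) f = partial_deriv i (iterated_partial_deriv is f)"

definition smooth :: "(real^'n \<Rightarrow> complex) \<Rightarrow> bool" where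
  "smooth f \<longleftrightarrow> (\<forall>is p. iterated_partial_deriv is f differentiable (at p))"

text \<open>A metric on a global coordinate chart \<open>real^'n\<close> is given pointwise as a
  bilinear form in the coordinate frame. The gradient uses its complex-bilinear extension:
  the components are those of the complex vector \<open>X\<close> with \<open>g(X, v) = df(v)\<close>.\<close>

type_synonym 'n metric = "real^'n \<Rightarrow> real^'n \<Rightarrow> real^'n \<Rightarrow> real"

definition gram :: "'n::finite metric \<Rightarrow> real^'n \<Rightarrow> real^'n^'n" where
  "gram g p = (\<chi> i j. g p (axis i 1) (axis j 1))"

definition gradient :: "'n::finite metric \<Rightarrow> (real^'n \<Rightarrow> complex) \<Rightarrow> real^'n \<Rightarrow> complex^'n" where
  "gradient g f p =
     (\<chi> i. \<Sum>j\<in>UNIV. of_real (matrix_inv (gram g p) $ i $ j) * partial_deriv j f p)"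

definition divergence :: "'n::finite metric \<Rightarrow> (real^'n \<Rightarrow> complex^'n) \<Rightarrow> real^'n \<Rightarrow> complex" where
  "divergence g X p =
     (\<Sum>i\<in>UNIV. partial_deriv i (\<lambda>q. of_real (sqrt (det (gram g q))) * X q $ i) p)
       / of_real (sqrt (det (gram g p)))"

definition laplace_beltrami ::
    "'n::finite metric \<Rightarrow> (real^'n \<Rightarrow> complex) \<Rightarrow> real^'n \<Rightarrow> complex" where
  "laplace_beltrami g f = divergence g (gradient g f)"

definition harmonic :: "'n::finite metric \<Rightarrow> (real^'n \<Rightarrow> complex) \<Rightarrow> bool" where
  "harmonic g f \<longleftrightarrow> smooth f \<and> (\<forall>p. laplace_beltrami g f p = 0)"

definition biharmonic :: "'n::finite metric \<Rightarrow> (real^'n \<Rightarrow> complex) \<Rightarrow> bool" where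
  "biharmonic g f \<longleftrightarrow>
     smooth f \<and> (\<forall>p. laplace_beltrami g (laplace_beltrami g f) p = 0)"

definition proper_biharmonic :: "'n::finite metric \<Rightarrow> (real^'n \<Rightarrow> complex) \<Rightarrow> bool" where
  "proper_biharmonic g f \<longleftrightarrow> biharmonic g f \<and> (\<exists>p. laplace_beltrami g f p \<noteq> 0)"

text \<open>The coordinates \<open>(x, y, t)\<close> are \<open>(p $ 1, p $ 2, p $ 3)\<close>.
  The metric is the polarisation of \<open>dx\<^sup>2 + dy\<^sup>2 + (dt - x dy)\<^sup>2\<close>.\<close>

definition nil_metric :: "3 metric" where
  "nil_metric p v w =
     v $ 1 * w $ 1 + v $ 2 * w $ 2 + (v $ 3 - p $ 1 * v $ 2) * (w $ 3 - p $ 1 * w $ 2)"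

abbreviation nil_laplacian :: "(real^3 \<Rightarrow> complex) \<Rightarrow> real^3 \<Rightarrow> complex" ("\<tau>") where
  "\<tau> \<equiv> laplace_beltrami nil_metric"

definition nil_f1 ::
    "(complex \<Rightarrow> complex) \<Rightarrow> (complex \<Rightarrow> complex) \<Rightarrow> complex^2 \<Rightarrow> real^3 \<Rightarrow> complex" where
  "nil_f1 h1 h2 a p =
     (let x = complex_of_real (p $ 1); y = complex_of_real (p $ 2); t = complex_of_real (p $ 3)
      in h1 (x + \<i> * y) + h2 (x - \<i> * y) + a $ 1 * t + a $ 2 * x * t)"

text \<open>In \<open>b :: complex^12\<close> the index \<open>12\<close> is \<open>0\<close> modulo 12, so \<open>1, \<dots>, 12\<close> enumerate all indices.\<close>

definition nil_f2 :: "complex^12 \<Rightarrow> real^3 \<Rightarrow> complex" where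
  "nil_f2 b p =
     (let x = complex_of_real (p $ 1); y = complex_of_real (p $ 2); t = complex_of_real (p $ 3)
      in b $ 1 * x^2 + b $ 2 * y^2 + b $ 3 * y * t + b $ 4 * x^3 + b $ 5 * x^2 * y
       + b $ 6 * x^2 * t + b $ 7 * x * y^2 + b $ 8 * y^3 + b $ 9 * x^3 * y
       + b $ 10 * x * y^3 + b $ 11 * y^2 * t + b $ 12 * x^3 * t)"

text \<open>Dimension of the complex span of a set of functions, under pointwise scaling.\<close>

lemma vector_space_fun_scale: "vector_space (\<lambda>(c::complex) f (p::'a). c * f p)"
  by unfold_locales (auto simp: fun_eq_iff algebra_simps)

abbreviation complex_fun_dim :: "('a \<Rightarrow> complex) set \<Rightarrow> nat" where
  "complex_fun_dim \<equiv> vector_space.dim (\<lambda>(c::complex) f p. c * f p)"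

lemma gram_nil_metric:
  "gram nil_metric p = vector [vector [1, 0, 0],
     vector [0, 1 + (p $ 1)\<^sup>2, - p $ 1], vector [0, - p $ 1, 1]]"
  by (simp add: gram_def nil_metric_def vec_eq_iff forall_3 axis_def power2_eq_square)

lemma det_gram_nil_metric: "det (gram nil_metric p) = 1"
  by (simp add: gram_nil_metric det_3 power2_eq_square)

lemma matrix_inv_gram_nil_metric:
  "matrix_inv (gram nil_metric p) = vector [vector [1, 0, 0],
     vector [0, 1, p $ 1], vector [0, p $ 1, 1 + (p $ 1)\<^sup>2]]"
  (is "_ = ?B")
proof -
  have *: "gram nil_metric p ** ?B = mat 1" "?B ** gram nil_metric p = mat 1"
    by (simp_all add: gram_nil_metric vec_eq_iff forall_3 matrix_matrix_mult_def sum_3 mat_def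
        power2_eq_square algebra_simps)
  then have "C = ?B" if "C ** gram nil_metric p = mat 1" for C
  proof -
    have "C = C ** (gram nil_metric p ** ?B)" by (simp only: *(1) matrix_mul_rid)
    also have "\<dots> = ?B" by (simp only: matrix_mul_assoc that matrix_mul_lid)
    finally show ?thesis .
  qed
  moreover have "matrix_inv (gram nil_metric p) ** gram nil_metric p = mat 1"
    unfolding matrix_inv_def using * by (metis (mono_tags, lifting) someI_ex)
  ultimately show ?thesis by blast
qed

lemma partial_deriv_works:
  fixes f :: "real^'n::finite \<Rightarrow> complex"
  assumes "f differentiable (at p)"
  shows "((\<lambda>s. f (p + s *\<^sub>R axis i 1)) has_vector_derivative partial_deriv i f p) (at 0)"
proof -
  have "(f \<circ> (\<lambda>s. p + s *\<^sub>R axis i 1)) differentiable (at 0)"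
    using assms by (intro differentiable_chain_at derivative_intros) auto
  then show ?thesis
    unfolding partial_deriv_def o_def vector_derivative_works .
qed

lemma partial_deriv_differentiable:
  "smooth f \<Longrightarrow> partial_deriv i f differentiable (at p)"
  unfolding smooth_def by (drule spec[of _ "[i]"]) simp

text \<open>For smooth \<open>f\<close> the two mixed derivatives agree and the middle term is the
  familiar \<open>2x\<close> times the mixed derivative in \<open>y\<close> and \<open>t\<close>.\<close>

lemma nil_laplacian_formula:
  assumes "smooth f"
  shows "\<tau> f p = partial_deriv 1 (partial_deriv 1 f) p + partial_deriv 2 (partial_deriv 2 f) p
     + of_real (p $ 1) * (partial_deriv 2 (partial_deriv 3 f) p + partial_deriv 3 (partial_deriv 2 f) p)
     + (1 + of_real (p $ 1)^2) * partial_deriv 3 (partial_deriv 3 f) p"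
proof -
  have [simp]: "(axis 2 1 :: real^3) $ 1 = 0" "(axis 3 1 :: real^3) $ 1 = 0"
    by (simp_all add: axis_def)
  define D where "D = (\<lambda>i. partial_deriv i f)"
  have grad: "gradient nil_metric f q $ 1 = D 1 q"
    "gradient nil_metric f q $ 2 = D 2 q + of_real (q $ 1) * D 3 q"
    "gradient nil_metric f q $ 3 = of_real (q $ 1) * D 2 q + (1 + of_real (q $ 1)^2) * D 3 q" for q
    by (simp_all add: gradient_def matrix_inv_gram_nil_metric sum_3 D_def)
  have d: "((\<lambda>s. D j (p + s *\<^sub>R axis i 1)) has_vector_derivative partial_deriv i (D j) p) (at 0)"
    for i j
    unfolding D_def by (rule partial_deriv_works[OF partial_deriv_differentiable[OF assms]])
  have "partial_deriv 2 (\<lambda>q. D 2 q + of_real (q $ 1) * D 3 q) p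
      = partial_deriv 2 (D 2) p + of_real (p $ 1) * partial_deriv 2 (D 3) p"
    unfolding partial_deriv_def[of 2 "\<lambda>q. D 2 q + of_real (q $ 1) * D 3 q"]
    by (rule vector_derivative_at)
      (simp, intro has_vector_derivative_add has_vector_derivative_mult_right d)
  moreover have "partial_deriv 3 (\<lambda>q. of_real (q $ 1) * D 2 q + (1 + of_real (q $ 1)^2) * D 3 q) p
      = of_real (p $ 1) * partial_deriv 3 (D 2) p
        + (1 + of_real (p $ 1)^2) * partial_deriv 3 (D 3) p"
    unfolding partial_deriv_def[of 3 "\<lambda>q. of_real (q $ 1) * D 2 q + (1 + of_real (q $ 1)^2) * D 3 q"]
    by (rule vector_derivative_at)
      (simp, intro has_vector_derivative_add has_vector_derivative_mult_right d)
  ultimately show ?thesis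
    by (simp add: laplace_beltrami_def divergence_def det_gram_nil_metric sum_3 grad
        algebra_simps) (simp add: D_def)
qed

end

theory Submission
  imports Defs "HOL-Complex_Analysis.Cauchy_Integral_Formula"
begin

text \<open>
  Write \<open>z = x + iy\<close> and \<open>w = x - iy\<close>. The functions
  \<open>h1(z) + h2(w) + a1 t + a2 x t\<close> with entire \<open>h1\<close>, \<open>h2\<close> form a family that is closed under
  all three coordinate derivatives: \<open>\<partial>/\<partial>t\<close> yields \<open>a1 + a2 x\<close>, which is absorbed into
  the holomorphic part because \<open>x = (z + w) / 2\<close>. The derivatives are explicit
  (\<open>partial_deriv_nil_f1\<close>), so closedness gives smoothness of every member at once
  (\<open>smooth_coinduct\<close>), and two applications give the terms of the Laplacian. There
  \<open>\<partial>\<^sup>2/\<partial>x\<^sup>2\<close> and \<open>\<partial>\<^sup>2/\<partial>y\<^sup>2\<close> cancel, and the terms involving \<open>t\<close> vanish.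

  The Laplacian of the polynomial \<open>f2\<close> is a direct computation. Its result is a
  combination of \<open>1, x, y, t, xy, xt\<close>, and \<open>xy = (z\<^sup>2 - w\<^sup>2) / 4i\<close>; it is thus itself a
  member of the first family. Hence biharmonicity of \<open>f2\<close> is an instance of the first part
  (\<open>harmonic_nil_laplacian_nil_f2\<close>).

  The coefficient vectors \<open>b\<close> for which \<open>f2\<close> fails to be proper biharmonic form the
  kernel of the linear map \<open>b \<mapsto> \<tau>(f2)\<close>, a proper subspace of \<open>\<complex>\<^sup>1\<^sup>2\<close>. The complement of a
  proper subspace is open, dense and spanning, and \<open>b \<mapsto> f2\<close> is linear and injective
  because the twelve monomials are independent; so the proper biharmonic members span a
  space of dimension 12.
\<close>

section \<open>Smooth functions\<close>

text \<open>To prove smoothness it suffices to exhibit an invariant: a class of differentiable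
  functions that partial derivatives do not leave. No iterated derivative has to be
  computed.\<close>

lemma smooth_coinduct:
  assumes "f \<in> S" "\<And>g p. g \<in> S \<Longrightarrow> g differentiable (at p)"
    and "\<And>g i. g \<in> S \<Longrightarrow> partial_deriv i g \<in> S"
  shows "smooth f"
proof -
  have "iterated_partial_deriv is f \<in> S" for "is"
    by (induction "is") (simp_all add: assms)
  then show ?thesis unfolding smooth_def using assms(2) by blast
qed

text \<open>Differentiating a product produces a sum of products, so the products of smooth
  functions alone are not closed under derivatives. The generated algebra is, by the
  Leibniz rule.\<close>

inductive_set smooth_algebra :: "(real^'n::finite \<Rightarrow> complex) set" where
  incl: "smooth f \<Longrightarrow> f \<in> smooth_algebra"
| add: "f \<in> smooth_algebra \<Longrightarrow> g \<in> smooth_algebra \<Longrightarrow> (\<lambda>p. f p + g p) \<in> smooth_algebra"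
| mult: "f \<in> smooth_algebra \<Longrightarrow> g \<in> smooth_algebra \<Longrightarrow> (\<lambda>p. f p * g p) \<in> smooth_algebra"

lemma smooth_differentiable: "smooth f \<Longrightarrow> f differentiable (at p)"
  unfolding smooth_def by (drule spec[of _ "[]"]) simp

lemma smooth_partial_deriv:
  assumes "smooth f" shows "smooth (partial_deriv i f)"
proof -
  have "iterated_partial_deriv is (partial_deriv i f) = iterated_partial_deriv (is @ [i]) f" for "is"
    by (induction "is") simp_all
  then show ?thesis using assms unfolding smooth_def by metis
qed

lemma partial_deriv_add:
  fixes f g :: "real^'n::finite \<Rightarrow> complex"
  assumes "\<And>p. f differentiable (at p)" "\<And>p. g differentiable (at p)"
  shows "partial_deriv i (\<lambda>p. f p + g p) = (\<lambda>p. partial_deriv i f p + partial_deriv i g p)"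
proof
  fix p
  show "partial_deriv i (\<lambda>p. f p + g p) p = partial_deriv i f p + partial_deriv i g p"
    unfolding partial_deriv_def[of i "\<lambda>p. f p + g p"]
    by (intro vector_derivative_at has_vector_derivative_add partial_deriv_works assms)
qed

lemma partial_deriv_mult:
  fixes f g :: "real^'n::finite \<Rightarrow> complex"
  assumes "\<And>p. f differentiable (at p)" "\<And>p. g differentiable (at p)"
  shows "partial_deriv i (\<lambda>p. f p * g p) = (\<lambda>p. f p * partial_deriv i g p + partial_deriv i f p * g p)"
proof
  fix p
  show "partial_deriv i (\<lambda>p. f p * g p) p = f p * partial_deriv i g p + partial_deriv i f p * g p"
    unfolding partial_deriv_def[of i "\<lambda>p. f p * g p"]
    using has_vector_derivative_mult[OF partial_deriv_works[OF assms(1)] partial_deriv_works[OF assms(2)], of p i p i]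
    by (intro vector_derivative_at) simp
qed

lemma smooth_algebra_closed:
  assumes "f \<in> smooth_algebra"
  shows "(\<forall>p. f differentiable (at p)) \<and> (\<forall>i. partial_deriv i f \<in> smooth_algebra)"
  using assms
proof induction
  case (incl f)
  then show ?case by (simp add: smooth_differentiable smooth_partial_deriv smooth_algebra.incl)
next
  case (add f g)
  then show ?case by (simp add: partial_deriv_add smooth_algebra.add)
next
  case (mult f g)
  then show ?case
    by (simp add: partial_deriv_mult smooth_algebra.add smooth_algebra.mult)
qed

lemma smooth_algebra_smooth: "f \<in> smooth_algebra \<Longrightarrow> smooth f"
  by (rule smooth_coinduct[of _ smooth_algebra]) (use smooth_algebra_closed in blast)+

lemma smooth_add: "smooth f \<Longrightarrow> smooth g \<Longrightarrow> smooth (\<lambda>p. f p + g p)"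
  and smooth_mult: "smooth f \<Longrightarrow> smooth g \<Longrightarrow> smooth (\<lambda>p. f p * g p)"
  by (simp_all add: smooth_algebra_smooth smooth_algebra.intros)

lemma partial_deriv_const: "partial_deriv i (\<lambda>p. c) = (\<lambda>p. 0)"
  by (simp add: partial_deriv_def fun_eq_iff)

lemma smooth_const: "smooth (\<lambda>p::real^'n::finite. c)"
  by (rule smooth_coinduct[of _ "range (\<lambda>c p. c)"]) (auto simp: partial_deriv_const)

lemma smooth_power: "smooth f \<Longrightarrow> smooth (\<lambda>p. f p ^ n)"
  by (induction n) (simp_all add: smooth_const smooth_mult)

lemma differentiable_coord:
  "(\<lambda>p::real^'n::finite. complex_of_real (p $ i)) differentiable (at p)"
  by (intro bounded_linear_imp_differentiable bounded_linear_compose[OF bounded_linear_of_real]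
      bounded_linear_vec_nth)

lemma smooth_coord: "smooth (\<lambda>p::real^'n::finite. complex_of_real (p $ i))"
proof (rule smooth_coinduct[of _ "insert (\<lambda>p. complex_of_real (p $ i)) (range (\<lambda>c p. c))"])
  have "((\<lambda>s. complex_of_real ((q + s *\<^sub>R axis j 1) $ i)) has_vector_derivative of_real (axis j 1 $ i)) (at 0)"
    for j and q :: "real^'n"
    unfolding has_vector_derivative_def vector_add_component vector_scaleR_component
    by (rule derivative_eq_intros refl | simp add: scaleR_conv_of_real)+
  then have "partial_deriv j (\<lambda>p. complex_of_real (p $ i)) q = of_real (axis j 1 $ i)" for j and q :: "real^'n"
    unfolding partial_deriv_def by (rule vector_derivative_at)
  then have "partial_deriv j (\<lambda>p::real^'n. complex_of_real (p $ i)) = (\<lambda>p. of_real (axis j 1 $ i))" for j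
    by auto
  then show "partial_deriv j g \<in> insert (\<lambda>p. complex_of_real (p $ i)) (range (\<lambda>c p. c))"
    if "g \<in> insert (\<lambda>p. complex_of_real (p $ i)) (range (\<lambda>c p. c))" for g :: "real^'n \<Rightarrow> complex" and j
    using that by (auto simp: partial_deriv_const)
qed (auto simp: differentiable_coord)

section \<open>Harmonic functions on Nil\<close>

text \<open>Presenting \<open>f\<close> as a function of complexified coordinates reduces partial derivatives
  to complex derivatives in one variable, where the derivative rules apply and where
  \<open>h(x + iy)\<close> for holomorphic \<open>h\<close> is handled by the ordinary chain rule.\<close>

lemma partial_deriv_coords:
  assumes f: "\<And>q. f q = F (complex_of_real (q $ 1)) (complex_of_real (q $ 2)) (complex_of_real (q $ 3))"
  defines "x \<equiv> \<lambda>q::real^3. complex_of_real (q $ 1)" and "y \<equiv> \<lambda>q::real^3. complex_of_real (q $ 2)"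
    and "t \<equiv> \<lambda>q::real^3. complex_of_real (q $ 3)"
  shows partial_deriv_x: "((\<lambda>z. F z (y p) (t p)) has_field_derivative D) (at (x p)) \<Longrightarrow> partial_deriv 1 f p = D"
    and partial_deriv_y: "((\<lambda>z. F (x p) z (t p)) has_field_derivative D) (at (y p)) \<Longrightarrow> partial_deriv 2 f p = D"
    and partial_deriv_t: "((\<lambda>z. F (x p) (y p) z) has_field_derivative D) (at (t p)) \<Longrightarrow> partial_deriv 3 f p = D"
proof -
  have *: "((\<lambda>s::real. G (w + of_real s)) has_vector_derivative D) (at 0)"
    if "(G has_field_derivative D) (at w)" for G and w :: complex
  proof -
    have "((\<lambda>z. G (w + z)) has_field_derivative D) (at (of_real 0))"
      using that DERIV_at_within_shift[of G D w 0 UNIV] by simp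
    then show ?thesis by (rule has_vector_derivative_real_field)
  qed
  have [simp]: "(axis i 1 :: real^3) $ j = (if j = i then 1 else 0)" for i j
    by (simp add: axis_def)
  show "partial_deriv 1 f p = D" if "((\<lambda>z. F z (y p) (t p)) has_field_derivative D) (at (x p))"
    unfolding partial_deriv_def f
    using *[OF that] by (intro vector_derivative_at) (simp add: x_def y_def t_def)
  show "partial_deriv 2 f p = D" if "((\<lambda>z. F (x p) z (t p)) has_field_derivative D) (at (y p))"
    unfolding partial_deriv_def f
    using *[OF that] by (intro vector_derivative_at) (simp add: x_def y_def t_def)
  show "partial_deriv 3 f p = D" if "((\<lambda>z. F (x p) (y p) z) has_field_derivative D) (at (t p))"
    unfolding partial_deriv_def f
    using *[OF that] by (intro vector_derivative_at) (simp add: x_def y_def t_def)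
qed

lemma nil_f1_eq:
  "nil_f1 h1 h2 a p =
     h1 (of_real (p $ 1) + \<i> * of_real (p $ 2)) + h2 (of_real (p $ 1) - \<i> * of_real (p $ 2))
     + a $ 1 * of_real (p $ 3) + a $ 2 * of_real (p $ 1) * of_real (p $ 3)"
  by (simp add: nil_f1_def Let_def)

lemma nil_f1_differentiable:
  assumes "h1 holomorphic_on UNIV" "h2 holomorphic_on UNIV"
  shows "nil_f1 h1 h2 a differentiable (at p)"
proof -
  have h: "(\<lambda>q. h (g q)) differentiable (at p)"
    if "h holomorphic_on UNIV" "g differentiable (at p)" for h g
    using differentiable_chain_at[of g p h] that
    by (simp add: o_def field_differentiable_imp_differentiable holomorphic_on_imp_differentiable_at)
  show ?thesis
    unfolding nil_f1_eq[abs_def]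
    by (intro differentiable_add differentiable_diff differentiable_mult differentiable_const
        differentiable_coord h[OF assms(1)] h[OF assms(2)])
qed

text \<open>The derivatives are written as members of the same family. For \<open>\<partial>/\<partial>t\<close> the value
  \<open>a1 + a2 x\<close> is split as \<open>(a1 + a2 z / 2) + a2 w / 2\<close>.\<close>

lemma partial_deriv_nil_f1:
  assumes h1: "h1 holomorphic_on UNIV" and h2: "h2 holomorphic_on UNIV"
  shows partial_deriv_x_nil_f1:
      "partial_deriv 1 (nil_f1 h1 h2 a) = nil_f1 (deriv h1) (deriv h2) (vector [a $ 2, 0])"
    and partial_deriv_y_nil_f1:
      "partial_deriv 2 (nil_f1 h1 h2 a) = nil_f1 (\<lambda>z. \<i> * deriv h1 z) (\<lambda>w. - \<i> * deriv h2 w) 0"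
    and partial_deriv_t_nil_f1:
      "partial_deriv 3 (nil_f1 h1 h2 a) = nil_f1 (\<lambda>z. a $ 1 + a $ 2 / 2 * z) (\<lambda>w. a $ 2 / 2 * w) 0"
proof -
  let ?F = "\<lambda>x y t. h1 (x + \<i> * y) + h2 (x - \<i> * y) + a $ 1 * t + a $ 2 * x * t"
  note coords = partial_deriv_coords[of "nil_f1 h1 h2 a" ?F, OF nil_f1_eq]
  have [derivative_intros]:
    "((\<lambda>z. h1 (g z)) has_field_derivative deriv h1 (g z) * D) (at z)"
    "((\<lambda>z. h2 (g z)) has_field_derivative deriv h2 (g z) * D) (at z)"
    if "(g has_field_derivative D) (at z)" for g D z
    using DERIV_chain2[OF holomorphic_derivI[OF h1 open_UNIV UNIV_I] that]
      DERIV_chain2[OF holomorphic_derivI[OF h2 open_UNIV UNIV_I] that] by auto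
  show "partial_deriv 1 (nil_f1 h1 h2 a) = nil_f1 (deriv h1) (deriv h2) (vector [a $ 2, 0])"
    by (rule ext, rule coords(1))
      (auto intro!: derivative_eq_intros simp: nil_f1_eq)
  show "partial_deriv 2 (nil_f1 h1 h2 a) = nil_f1 (\<lambda>z. \<i> * deriv h1 z) (\<lambda>w. - \<i> * deriv h2 w) 0"
    by (rule ext, rule coords(2))
      (auto intro!: derivative_eq_intros simp: nil_f1_eq)
  show "partial_deriv 3 (nil_f1 h1 h2 a) = nil_f1 (\<lambda>z. a $ 1 + a $ 2 / 2 * z) (\<lambda>w. a $ 2 / 2 * w) 0"
    by (rule ext, rule coords(3))
      (auto intro!: derivative_eq_intros simp: nil_f1_eq field_simps)
qed

lemma smooth_nil_f1:
  assumes "h1 holomorphic_on UNIV" "h2 holomorphic_on UNIV"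
  shows "smooth (nil_f1 h1 h2 a)"
proof -
  define S where "S = {nil_f1 h1 h2 a | h1 h2 a. h1 holomorphic_on UNIV \<and> h2 holomorphic_on UNIV}"
  have "nil_f1 h1 h2 a \<in> S" using assms unfolding S_def by blast
  moreover have "g differentiable (at p)" if "g \<in> S" for g p
    using that nil_f1_differentiable unfolding S_def by auto
  moreover have "partial_deriv i g \<in> S" if g: "g \<in> S" for g i
  proof -
    obtain h1 h2 a where g_eq: "g = nil_f1 h1 h2 a"
      and h: "h1 holomorphic_on UNIV" "h2 holomorphic_on UNIV" using g unfolding S_def by blast
    have hol: "deriv h1 holomorphic_on UNIV" "deriv h2 holomorphic_on UNIV"
      "(\<lambda>z. \<i> * deriv h1 z) holomorphic_on UNIV" "(\<lambda>w. - \<i> * deriv h2 w) holomorphic_on UNIV"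
      "(\<lambda>z. a $ 1 + a $ 2 / 2 * z) holomorphic_on UNIV" "(\<lambda>w. a $ 2 / 2 * w) holomorphic_on UNIV"
      by (intro holomorphic_intros h open_UNIV)+
    have family: "nil_f1 k1 k2 c \<in> S" if "k1 holomorphic_on UNIV" "k2 holomorphic_on UNIV" for k1 k2 c
      using that unfolding S_def by blast
    have "partial_deriv 1 g \<in> S" "partial_deriv 2 g \<in> S" "partial_deriv 3 g \<in> S"
      unfolding g_eq partial_deriv_nil_f1[OF h]
      by (rule family; rule hol)+
    moreover have "i = 1 \<or> i = 2 \<or> i = 3" by (rule exhaust_3)
    ultimately show ?thesis by (elim disjE) (simp_all only:)
  qed
  ultimately show ?thesis by (rule smooth_coinduct)
qed

lemma harmonic_nil_f1:
  assumes h: "h1 holomorphic_on UNIV" "h2 holomorphic_on UNIV"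
  shows "harmonic nil_metric (nil_f1 h1 h2 a)"
proof -
  have dh: "deriv h1 holomorphic_on UNIV" "deriv h2 holomorphic_on UNIV"
    by (intro holomorphic_deriv h open_UNIV)+
  have "(\<lambda>z. \<i> * deriv h1 z) holomorphic_on UNIV" "(\<lambda>w. - \<i> * deriv h2 w) holomorphic_on UNIV"
    "(\<lambda>z. a $ 1 + a $ 2 / 2 * z) holomorphic_on UNIV" "(\<lambda>w. a $ 2 / 2 * w) holomorphic_on UNIV"
    by (intro holomorphic_intros dh)+
  moreover have "deriv (\<lambda>z. c * h z) z = c * deriv h z" "deriv (\<lambda>z. - (c * h z)) z = - (c * deriv h z)" if "h holomorphic_on UNIV" for c z and h :: "complex \<Rightarrow> complex"
    using that holomorphic_derivI[OF that open_UNIV, of z]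
    by (auto intro!: DERIV_imp_deriv derivative_eq_intros)
  moreover have "deriv (\<lambda>z. c + d * z / 2) z = d / 2" "deriv (\<lambda>z. d * z / 2) z = d / 2" for c d z :: complex
    by (rule DERIV_imp_deriv, auto intro!: derivative_eq_intros)+
  ultimately have "\<tau> (nil_f1 h1 h2 a) p = 0" for p
    using smooth_nil_f1[OF h, of a] h dh
    by (simp add: nil_laplacian_formula partial_deriv_nil_f1 nil_f1_eq)
  then show ?thesis using smooth_nil_f1[OF h] by (simp add: harmonic_def)
qed

text \<open>On the line through \<open>(x, 0, 0)\<close> in direction \<open>t\<close> the holomorphic parts are constant,
  which leaves \<open>a1 + a2 x\<close> as the slope; two values of \<open>x\<close> determine \<open>a\<close>.\<close>

lemma nil_f1_eq_const_imp:
  assumes "\<And>p. nil_f1 h1 h2 a p = c"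
  shows "a = 0"
proof -
  have "nil_f1 h1 h2 a (vector [x, 0, t]) = nil_f1 h1 h2 a (vector [x, 0, 0])" for x t
    by (simp add: assms)
  then have *: "a $ 1 * of_real t + a $ 2 * of_real x * of_real t = 0" for x t
    by (simp add: nil_f1_eq add.assoc)
  show ?thesis
    using *[of 1 0] *[of 1 1] by (simp add: vec_eq_iff forall_2)
qed

section \<open>Biharmonic polynomials on Nil\<close>

lemma nil_f2_eq:
  "nil_f2 b p =
     b $ 1 * of_real (p $ 1)^2 + b $ 2 * of_real (p $ 2)^2 + b $ 3 * of_real (p $ 2) * of_real (p $ 3)
     + b $ 4 * of_real (p $ 1)^3 + b $ 5 * of_real (p $ 1)^2 * of_real (p $ 2)
     + b $ 6 * of_real (p $ 1)^2 * of_real (p $ 3) + b $ 7 * of_real (p $ 1) * of_real (p $ 2)^2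
     + b $ 8 * of_real (p $ 2)^3 + b $ 9 * of_real (p $ 1)^3 * of_real (p $ 2)
     + b $ 10 * of_real (p $ 1) * of_real (p $ 2)^3 + b $ 11 * of_real (p $ 2)^2 * of_real (p $ 3)
     + b $ 12 * of_real (p $ 1)^3 * of_real (p $ 3)"
  by (simp add: nil_f2_def Let_def)

lemma smooth_nil_f2: "smooth (nil_f2 b)"
  unfolding nil_f2_eq[abs_def]
  by (intro smooth_add smooth_mult smooth_power smooth_const smooth_coord)

lemma nil_laplacian_nil_f2:
  fixes b p
  defines "x \<equiv> complex_of_real (p $ 1)" and "y \<equiv> complex_of_real (p $ 2)"
    and "t \<equiv> complex_of_real (p $ 3)"
  shows "\<tau> (nil_f2 b) p = 2 * b $ 1 + 2 * b $ 2 + 2 * b $ 3 * x + 6 * b $ 4 * x + 2 * b $ 5 * y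
    + 2 * b $ 6 * t + 2 * b $ 7 * x + 6 * b $ 8 * y + 6 * b $ 9 * x * y
    + 6 * b $ 10 * x * y + 2 * b $ 11 * (t + 2 * x * y) + 6 * b $ 12 * x * t"
proof -
  define D1 where "D1 x y t = 2 * b $ 1 * x + 3 * b $ 4 * x^2 + 2 * b $ 5 * x * y + 2 * b $ 6 * x * t
    + b $ 7 * y^2 + 3 * b $ 9 * x^2 * y + b $ 10 * y^3 + 3 * b $ 12 * x^2 * t" for x y t
  define D2 where "D2 x y t = 2 * b $ 2 * y + b $ 3 * t + b $ 5 * x^2 + 2 * b $ 7 * x * y
    + 3 * b $ 8 * y^2 + b $ 9 * x^3 + 3 * b $ 10 * x * y^2 + 2 * b $ 11 * y * t" for x y t
  define D3 where "D3 x y t = b $ 3 * y + b $ 6 * x^2 + b $ 11 * y^2 + b $ 12 * x^3" for x y t :: complex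
  define lift where "lift F q = F (complex_of_real (q $ 1)) (complex_of_real (q $ 2)) (complex_of_real (q $ 3))"
    for F :: "complex \<Rightarrow> complex \<Rightarrow> complex \<Rightarrow> complex" and q :: "real^3"
  note coords = partial_deriv_coords[of "lift F" F for F, OF lift_def]
  define F where "F x y t = b $ 1 * x^2 + b $ 2 * y^2 + b $ 3 * y * t + b $ 4 * x^3 + b $ 5 * x^2 * y
       + b $ 6 * x^2 * t + b $ 7 * x * y^2 + b $ 8 * y^3 + b $ 9 * x^3 * y
       + b $ 10 * x * y^3 + b $ 11 * y^2 * t + b $ 12 * x^3 * t" for x y t
  have f: "nil_f2 b = lift F"
    by (rule ext) (simp add: nil_f2_eq lift_def F_def)
  have "partial_deriv 1 (lift F) = lift D1"
    by (rule ext, rule coords(1), unfold F_def)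
      (auto intro!: derivative_eq_intros simp: lift_def D1_def algebra_simps)
  moreover have "partial_deriv 2 (lift F) = lift D2"
    by (rule ext, rule coords(2), unfold F_def)
      (auto intro!: derivative_eq_intros simp: lift_def D2_def algebra_simps)
  moreover have "partial_deriv 3 (lift F) = lift D3"
    by (rule ext, rule coords(3), unfold F_def)
      (auto intro!: derivative_eq_intros simp: lift_def D3_def algebra_simps)
  moreover have "partial_deriv 1 (lift D1) p = 2 * b $ 1 + 6 * b $ 4 * x + 2 * b $ 5 * y
      + 2 * b $ 6 * t + 6 * b $ 9 * x * y + 6 * b $ 12 * x * t"
    unfolding x_def y_def t_def
    by (rule coords(1), unfold D1_def) (auto intro!: derivative_eq_intros simp: algebra_simps)
  moreover have "partial_deriv 2 (lift D2) p = 2 * b $ 2 + 2 * b $ 7 * x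
      + 6 * b $ 8 * y + 6 * b $ 10 * x * y + 2 * b $ 11 * t"
    unfolding x_def y_def t_def
    by (rule coords(2), unfold D2_def) (auto intro!: derivative_eq_intros simp: algebra_simps)
  moreover have "partial_deriv 2 (lift D3) p = b $ 3 + 2 * b $ 11 * y"
    unfolding x_def y_def t_def
    by (rule coords(2), unfold D3_def) (auto intro!: derivative_eq_intros simp: algebra_simps)
  moreover have "partial_deriv 3 (lift D2) p = b $ 3 + 2 * b $ 11 * y"
    unfolding x_def y_def t_def
    by (rule coords(3), unfold D2_def) (auto intro!: derivative_eq_intros simp: algebra_simps)
  moreover have "partial_deriv 3 (lift D3) p = 0"
    by (rule coords(3), unfold D3_def) (auto intro!: derivative_eq_intros)
  ultimately show ?thesis
    using nil_laplacian_formula[OF smooth_nil_f2, of b p]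
    by (simp add: f flip: x_def) (simp add: algebra_simps)
qed

text \<open>In terms of \<open>z\<close> and \<open>w\<close>: \<open>l x + m y = (l - im) z / 2 + (l + im) w / 2\<close> and
  \<open>2 c x y = - i c z\<^sup>2 / 2 + i c w\<^sup>2 / 2\<close>.\<close>

lemma harmonic_nil_laplacian_nil_f2: "harmonic nil_metric (\<tau> (nil_f2 b))"
proof -
  define c where "c = 3 * b $ 9 + 3 * b $ 10 + 2 * b $ 11"
  define l m where "l = 2 * b $ 3 + 6 * b $ 4 + 2 * b $ 7" and "m = 2 * b $ 5 + 6 * b $ 8"
  define h1 where "h1 z = 2 * b $ 1 + 2 * b $ 2 + (l - \<i> * m) / 2 * z - \<i> / 2 * c * z^2" for z
  define h2 where "h2 w = (l + \<i> * m) / 2 * w + \<i> / 2 * c * w^2" for w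
  have "\<tau> (nil_f2 b) = nil_f1 h1 h2 (vector [2 * b $ 6 + 2 * b $ 11, 6 * b $ 12])"
    by (rule ext) (simp add: nil_laplacian_nil_f2 nil_f1_eq h1_def h2_def c_def l_def m_def
        power2_eq_square field_simps)
  moreover have "h1 holomorphic_on UNIV" "h2 holomorphic_on UNIV"
    unfolding h1_def h2_def by (intro holomorphic_intros)+
  ultimately show ?thesis using harmonic_nil_f1 by simp
qed

definition harmonic_coeffs :: "(complex^12) set" where
  "harmonic_coeffs = {b. b $ 1 + b $ 2 = 0 \<and> b $ 3 + 3 * b $ 4 + b $ 7 = 0 \<and> b $ 5 + 3 * b $ 8 = 0
     \<and> b $ 6 + b $ 11 = 0 \<and> 3 * b $ 9 + 3 * b $ 10 + 2 * b $ 11 = 0 \<and> b $ 12 = 0}"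

text \<open>The six equations are the vanishing of the coefficients of \<open>1, x, y, t, xy, xt\<close> in the
  Laplacian; evaluation at points with coordinates 0 and 1 separates these monomials.\<close>

lemma laplacian_nil_f2_eq_0_iff: "(\<forall>p. \<tau> (nil_f2 b) p = 0) \<longleftrightarrow> b \<in> harmonic_coeffs"
proof
  define c where "c = 3 * b $ 9 + 3 * b $ 10 + 2 * b $ 11"
  define l m where "l = b $ 3 + 3 * b $ 4 + b $ 7" and "m = b $ 5 + 3 * b $ 8"
  have eq: "\<tau> (nil_f2 b) (vector [x, y, t]) = 2 * (b $ 1 + b $ 2 + l * of_real x + m * of_real y
      + (b $ 6 + b $ 11) * of_real t + c * of_real x * of_real y + 3 * b $ 12 * of_real x * of_real t)" for x y t
    by (simp add: nil_laplacian_nil_f2 c_def l_def m_def algebra_simps)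
  assume "\<forall>p. \<tau> (nil_f2 b) p = 0"
  then have *: "b $ 1 + b $ 2 + l * of_real x + m * of_real y
      + (b $ 6 + b $ 11) * of_real t + c * of_real x * of_real y + 3 * b $ 12 * of_real x * of_real t = 0" for x y t
    using eq[of x y t] by (metis mult_eq_0_iff zero_neq_numeral)
  have "b $ 1 + b $ 2 = 0" using *[of 0 0 0] by simp
  moreover from this have "l = 0" "m = 0" "b $ 6 + b $ 11 = 0"
    using *[of 1 0 0] *[of 0 1 0] *[of 0 0 1] by simp_all
  moreover from calculation have "c = 0" "b $ 12 = 0"
    using *[of 1 1 0] *[of 1 0 1] by simp_all
  ultimately show "b \<in> harmonic_coeffs" by (simp add: harmonic_coeffs_def l_def m_def c_def)
next
  assume b: "b \<in> harmonic_coeffs"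
  then have coeffs: "b $ 1 + b $ 2 = 0" "b $ 3 + 3 * b $ 4 + b $ 7 = 0" "b $ 5 + 3 * b $ 8 = 0"
    "b $ 6 + b $ 11 = 0" "3 * b $ 9 + 3 * b $ 10 + 2 * b $ 11 = 0" "b $ 12 = 0"
    by (simp_all add: harmonic_coeffs_def)
  have "\<tau> (nil_f2 b) p = 2 * (b $ 1 + b $ 2) + 2 * (b $ 3 + 3 * b $ 4 + b $ 7) * of_real (p $ 1)
      + 2 * (b $ 5 + 3 * b $ 8) * of_real (p $ 2) + 2 * (b $ 6 + b $ 11) * of_real (p $ 3)
      + 2 * (3 * b $ 9 + 3 * b $ 10 + 2 * b $ 11) * of_real (p $ 1) * of_real (p $ 2)
      + 6 * b $ 12 * of_real (p $ 1) * of_real (p $ 3)" for p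
    by (simp add: nil_laplacian_nil_f2 algebra_simps)
  then show "\<forall>p. \<tau> (nil_f2 b) p = 0" by (simp only: coeffs) simp
qed

lemma biharmonic_nil_f2: "biharmonic nil_metric (nil_f2 b)"
  using harmonic_nil_laplacian_nil_f2 smooth_nil_f2 by (simp add: biharmonic_def harmonic_def)

lemma proper_biharmonic_nil_f2_iff:
  "proper_biharmonic nil_metric (nil_f2 b) \<longleftrightarrow> b \<notin> harmonic_coeffs"
  using laplacian_nil_f2_eq_0_iff biharmonic_nil_f2 by (auto simp: proper_biharmonic_def)

section \<open>The family of proper biharmonic polynomials\<close>

lemma linear_nil_f2: "Vector_Spaces.linear (*s) (\<lambda>(c::complex) f p. c * f p) nil_f2"
  unfolding Vector_Spaces.linear_iff
  using vec.vector_space_axioms vector_space_fun_scale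
  by (auto simp: fun_eq_iff nil_f2_eq algebra_simps)

lemma exhaust_12:
  fixes i :: 12
  shows "i = 1 \<or> i = 2 \<or> i = 3 \<or> i = 4 \<or> i = 5 \<or> i = 6 \<or> i = 7 \<or> i = 8 \<or> i = 9 \<or> i = 10
    \<or> i = 11 \<or> i = 12"
proof (induct i)
  case (of_int z)
  then have "0 \<le> z" "z < 12" by simp_all
  then have "z = 0 \<or> z = 1 \<or> z = 2 \<or> z = 3 \<or> z = 4 \<or> z = 5 \<or> z = 6 \<or> z = 7 \<or> z = 8 \<or> z = 9 \<or> z = 10
    \<or> z = 11" by arith
  then show ?case by auto
qed

text \<open>The twelve monomials are separated by their values at few points: first on the axes and
  in the coordinate planes containing the \<open>t\<close>-axis, where sign changes of a coordinate
  split even from odd powers, then in the plane \<open>t = 0\<close>. There \<open>x\<^sup>3 y\<close> and \<open>x y\<^sup>3\<close> have the same parities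
  and agree at \<open>(\<plusminus>1, \<plusminus>1)\<close>, so the point \<open>(2, 1)\<close> is needed as well.\<close>

lemma inj_nil_f2: "inj nil_f2"
proof (rule injI)
  fix b b' assume eq: "nil_f2 b = nil_f2 b'"
  define d where "d = b - b'"
  have "nil_f2 d p = nil_f2 b p - nil_f2 b' p" for p
    by (simp add: d_def nil_f2_eq algebra_simps)
  then have *: "nil_f2 d (vector [x, y, t]) = 0" for x y t by (simp add: eq)
  have "d $ 1 + d $ 4 = 0" "d $ 1 - d $ 4 = 0" using *[of 1 0 0] *[of "-1" 0 0] by (simp_all add: nil_f2_eq)
  then have 1: "d $ 1 = 0" "d $ 4 = 0" by algebra+
  have "d $ 2 + d $ 8 = 0" "d $ 2 - d $ 8 = 0" using *[of 0 1 0] *[of 0 "-1" 0] by (simp_all add: nil_f2_eq)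
  then have 2: "d $ 2 = 0" "d $ 8 = 0" by algebra+
  have "d $ 11 + d $ 3 = 0" "d $ 11 - d $ 3 = 0" using *[of 0 1 1] *[of 0 "-1" 1] by (simp_all add: nil_f2_eq 2)
  then have 3: "d $ 3 = 0" "d $ 11 = 0" by algebra+
  have "d $ 6 + d $ 12 = 0" "d $ 6 - d $ 12 = 0" using *[of 1 0 1] *[of "-1" 0 1] by (simp_all add: nil_f2_eq 1)
  then have 4: "d $ 6 = 0" "d $ 12 = 0" by algebra+
  have "d $ 5 + d $ 7 + d $ 9 + d $ 10 = 0" "d $ 5 - d $ 7 - d $ 9 - d $ 10 = 0"
    "- d $ 5 + d $ 7 - d $ 9 - d $ 10 = 0" "4 * d $ 5 + 2 * d $ 7 + 8 * d $ 9 + 2 * d $ 10 = 0"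
    using *[of 1 1 0] *[of "-1" 1 0] *[of 1 "-1" 0] *[of 2 1 0]
    by (simp_all add: nil_f2_eq 1 2 3 4 mult.commute)
  then have "d $ 5 = 0" "d $ 7 = 0" "d $ 9 = 0" "d $ 10 = 0" by algebra+
  then have "d $ i = 0" for i using exhaust_12[of i] 1 2 3 4 by auto
  then show "b = b'" by (simp add: d_def vec_eq_iff)
qed

text \<open>Given \<open>v\<close> outside \<open>W\<close>, an element \<open>w\<close> of \<open>W\<close> is the difference of \<open>w + v\<close> and \<open>v\<close>,
  both of which lie outside \<open>W\<close>.\<close>

lemma (in module) span_Compl_subspace:
  assumes "subspace W" "W \<noteq> UNIV"
  shows "span (- W) = UNIV"
proof -
  obtain v where v: "v \<notin> W" using assms by auto
  have "w \<in> span (- W)" for w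
  proof (cases "w \<in> W")
    case True
    have "w + v \<notin> W"
    proof
      assume "w + v \<in> W"
      then have "w + v - w \<in> W" using True assms(1) by (intro subspace_diff)
      then show False using v by simp
    qed
    then have "w + v - v \<in> span (- W)" using v by (intro span_diff span_base) auto
    then show ?thesis by simp
  qed (auto intro: span_base)
  then show ?thesis by auto
qed

lemma open_dense_Compl_subspace:
  fixes W :: "'a::euclidean_space set"
  assumes "subspace W" "W \<noteq> UNIV"
  shows "open (- W)" "closure (- W) = UNIV"
proof -
  show "open (- W)" using assms(1) by (simp add: closed_subspace open_Compl)
  have "dim W < DIM('a)"
    using assms dim_eq_full[of W] dim_subset_UNIV[of W] span_eq_iff[of W]
    by (metis le_neq_implies_less)
  then show "closure (- W) = UNIV"
    by (simp add: closure_complement empty_interior_lowdim)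
qed

lemma harmonic_coeffs_ne_UNIV: "harmonic_coeffs \<noteq> UNIV"
proof -
  have "(axis 12 1 :: complex^12) \<notin> harmonic_coeffs"
    by (simp add: harmonic_coeffs_def axis_def)
  then show ?thesis by blast
qed

lemma vec_subspace_harmonic_coeffs: "vec.subspace harmonic_coeffs"
  unfolding vec.subspace_def harmonic_coeffs_def
  by (simp; algebra)

lemma subspace_harmonic_coeffs: "subspace harmonic_coeffs"
proof -
  have "r *\<^sub>R b = complex_of_real r *s b" for r and b :: "complex^12"
    unfolding vec_eq_iff vector_scaleR_component vector_smult_component
    by (simp add: scaleR_conv_of_real)
  then show ?thesis
    using vec_subspace_harmonic_coeffs unfolding vec.subspace_def subspace_def by metis
qed

lemma complex_fun_dim_nil_f2:
  "complex_fun_dim {nil_f2 b | b. proper_biharmonic nil_metric (nil_f2 b)} = 12"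
proof -
  have pair: "finite_dimensional_vector_space_pair_1 ((*s) :: complex \<Rightarrow> complex^12 \<Rightarrow> complex^12) cart_basis
    (\<lambda>(c::complex) f (p::real^3). c * f p)"
    by (intro finite_dimensional_vector_space_pair_1.intro vec.finite_dimensional_vector_space_axioms
        vector_space_fun_scale)
  have "{nil_f2 b | b. proper_biharmonic nil_metric (nil_f2 b)} = nil_f2 ` (- harmonic_coeffs)"
    by (auto simp: proper_biharmonic_nil_f2_iff)
  then have "complex_fun_dim {nil_f2 b | b. proper_biharmonic nil_metric (nil_f2 b)}
      = vec.dim (- harmonic_coeffs)"
    using finite_dimensional_vector_space_pair_1.dim_image_eq[OF pair linear_nil_f2 inj_on_subset[OF inj_nil_f2]]
    by simp
  also have "\<dots> = vec.dim (UNIV :: (complex^12) set)"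
    using vec.span_Compl_subspace[OF vec_subspace_harmonic_coeffs harmonic_coeffs_ne_UNIV]
    by (metis vec.dim_span)
  finally show ?thesis by (simp only: vec_dim_card) simp
qed

theorem mainTheorem3:
  shows
    "(\<forall>h1 h2 :: complex \<Rightarrow> complex. \<forall>a :: complex^2.
        h1 holomorphic_on UNIV \<and> h2 holomorphic_on UNIV \<and> a \<noteq> 0 \<longrightarrow>
          \<not> nil_f1 h1 h2 a constant_on UNIV
          \<and> nil_f1 h1 h2 a \<noteq> (\<lambda>p. 0)
          \<and> harmonic nil_metric (nil_f1 h1 h2 a))
   \<and> (\<forall>b :: complex^12. b \<noteq> 0 \<longrightarrow>
        (\<forall>p. let x = complex_of_real (p $ 1); y = complex_of_real (p $ 2);
                 t = complex_of_real (p $ 3)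
             in \<tau> (nil_f2 b) p
                  = 2 * b $ 1 + 2 * b $ 2 + 2 * b $ 3 * x + 6 * b $ 4 * x + 2 * b $ 5 * y
                  + 2 * b $ 6 * t + 2 * b $ 7 * x + 6 * b $ 8 * y + 6 * b $ 9 * x * y
                  + 6 * b $ 10 * x * y + 2 * b $ 11 * (t + 2 * x * y) + 6 * b $ 12 * x * t)
        \<and> (\<forall>p. \<tau> (\<tau> (nil_f2 b)) p = 0)
        \<and> biharmonic nil_metric (nil_f2 b)
        \<and> (proper_biharmonic nil_metric (nil_f2 b) \<longleftrightarrow>
             \<not> (b $ 1 + b $ 2 = 0 \<and> b $ 3 + 3 * b $ 4 + b $ 7 = 0 \<and> b $ 5 + 3 * b $ 8 = 0
                \<and> b $ 6 + b $ 11 = 0 \<and> 3 * b $ 9 + 3 * b $ 10 + 2 * b $ 11 = 0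
                \<and> b $ 12 = 0)))
   \<and> inj nil_f2
   \<and> open {b. proper_biharmonic nil_metric (nil_f2 b)}
   \<and> closure {b. proper_biharmonic nil_metric (nil_f2 b)} = UNIV
   \<and> complex_fun_dim {nil_f2 b | b. proper_biharmonic nil_metric (nil_f2 b)} = 12"
proof (intro conjI allI impI; (elim conjE)?)
  fix h1 h2 :: "complex \<Rightarrow> complex" and a :: "complex^2"
  assume h: "h1 holomorphic_on UNIV" "h2 holomorphic_on UNIV" and a: "a \<noteq> 0"
  show "\<not> nil_f1 h1 h2 a constant_on UNIV"
    using a nil_f1_eq_const_imp by (metis constant_on_def UNIV_I)
  show "nil_f1 h1 h2 a \<noteq> (\<lambda>p. 0)"
    using a nil_f1_eq_const_imp by metis
  show "harmonic nil_metric (nil_f1 h1 h2 a)"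
    by (rule harmonic_nil_f1[OF h])
next
  show "open {b. proper_biharmonic nil_metric (nil_f2 b)}"
    and "closure {b. proper_biharmonic nil_metric (nil_f2 b)} = UNIV"
    using open_dense_Compl_subspace[OF subspace_harmonic_coeffs harmonic_coeffs_ne_UNIV]
    by (simp_all add: proper_biharmonic_nil_f2_iff Compl_eq)
  show "complex_fun_dim {nil_f2 b | b. proper_biharmonic nil_metric (nil_f2 b)} = 12"
    by (rule complex_fun_dim_nil_f2)
qed (use biharmonic_nil_f2 in \<open>simp_all add: Let_def nil_laplacian_nil_f2 inj_nil_f2
    biharmonic_def proper_biharmonic_nil_f2_iff harmonic_coeffs_def\<close>)

end
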